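(* Let $K$ be a compact Hausdorff space and let $X$ be a Banach space. Let $\kappa$ be an infinite cardinal, let $(K_\alpha)_{\alpha<\kappa}$ be a collection of pairwise disjoint non-empty clopen subsets of $K$, and let $(P_\alpha)_{\alpha<\kappa}$ be a family of projections defined on $X$, with $P_\alpha[X]=X_\alpha$ for each $\alpha<\kappa$, such that the formula $x\mapsto (P_\alpha(x))_{\alpha<\kappa}$ defines a bounded linear operator from $X$ to $\left(\bigoplus_{\alpha<\kappa}X_\alpha\right)_{c_0}$. Then $C(K,X)$ has a complemented subspace isomorphic to $\left(\bigoplus_{\alpha<\kappa}C(K_\alpha,X_\alpha)\right)_{c_0}$.
   Context: For a compact Hausdorff space $K$ and a Banach space $X$, $C(K,X)$ is the Banach space of all continuous functions $f:K\to X$ with norm $\|f\|=\sup_{t\in K}\|f(t)\|$. A projection on a Banach space $X$ is a bounded linear operator $P:X\to X$ with $P^2=P$; its image $P[X]$ is then called a complemented subspace of $X$. For a family $(X_i)_{i\in\Gamma}$ of Banach spaces, $\left(\bigoplus_{i\in\Gamma}X_i\right)_{c_0}$ denotes their $c_0$-sum: the families $(x_i)_{i\in\Gamma}$ with $x_i\in X_i$ such that $\{i:\|x_i\|\geq\epsilon\}$ is finite for every $\epsilon>0$, with the supremum norm. Isomorphic means linearly homeomorphic. *)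

theory Defs
  imports "HOL-Analysis.Analysis"
begin

text \<open>
  The spaces \<open>C(K\<^sub>\<alpha>, X\<^sub>\<alpha>)\<close> and the \<open>c\<^sub>0\<close>-sums of families of spaces depend on
  terms, so they cannot be types of class \<^class>\<open>real_normed_vector\<close>. They are represented
  by an explicit carrier with its operations and norm; outside the carrier these are irrelevant.
  All scalars are real.
\<close>

record 'a nspace =
  ncarrier :: "'a set"
  nadd :: "'a \<Rightarrow> 'a \<Rightarrow> 'a"
  nscale :: "real \<Rightarrow> 'a \<Rightarrow> 'a"
  nnorm :: "'a \<Rightarrow> real"

definition subspace_nspace :: "'a::real_normed_vector set \<Rightarrow> 'a nspace" where
  "subspace_nspace S = \<lparr>ncarrier = S, nadd = (+), nscale = (*\<^sub>R), nnorm = norm\<rparr>"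

text \<open>
  \<open>C(A, Y)\<close> for a non-empty compact set \<open>A\<close> and a linear subspace \<open>Y\<close>, both with the subspace
  topology. Functions on \<open>A\<close> are represented as extensional functions. If \<open>A\<close> is empty, the
  norm is the unspecified real \<open>Sup {}\<close>.
\<close>

definition C_nspace :: "'k::topological_space set \<Rightarrow> 'x::real_normed_vector set \<Rightarrow> ('k \<Rightarrow> 'x) nspace" where
  "C_nspace A Y =
     \<lparr>ncarrier = {f \<in> A \<rightarrow>\<^sub>E Y. continuous_on A f},
      nadd = (\<lambda>f g. \<lambda>t\<in>A. f t + g t),
      nscale = (\<lambda>c f. \<lambda>t\<in>A. c *\<^sub>R f t),
      nnorm = (\<lambda>f. SUP t\<in>A. norm (f t))\<rparr>"

text \<open>The \<open>c\<^sub>0\<close>-sum over a non-empty index set \<open>I\<close>; families are extensional functions on \<open>I\<close>.\<close>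

definition c0_sum :: "'i set \<Rightarrow> ('i \<Rightarrow> 'a nspace) \<Rightarrow> ('i \<Rightarrow> 'a) nspace" where
  "c0_sum I V =
     \<lparr>ncarrier = {x \<in> (\<Pi>\<^sub>E i\<in>I. ncarrier (V i)). \<forall>\<epsilon>>0. finite {i \<in> I. nnorm (V i) (x i) \<ge> \<epsilon>}},
      nadd = (\<lambda>x y. \<lambda>i\<in>I. nadd (V i) (x i) (y i)),
      nscale = (\<lambda>c x. \<lambda>i\<in>I. nscale (V i) c (x i)),
      nnorm = (\<lambda>x. SUP i\<in>I. nnorm (V i) (x i))\<rparr>"

definition nlinear :: "'a nspace \<Rightarrow> 'b nspace \<Rightarrow> ('a \<Rightarrow> 'b) \<Rightarrow> bool" where
  "nlinear V W T \<longleftrightarrow>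
     T \<in> ncarrier V \<rightarrow> ncarrier W \<and>
     (\<forall>x\<in>ncarrier V. \<forall>y\<in>ncarrier V. T (nadd V x y) = nadd W (T x) (T y)) \<and>
     (\<forall>c. \<forall>x\<in>ncarrier V. T (nscale V c x) = nscale W c (T x))"

definition nbounded_linear :: "'a nspace \<Rightarrow> 'b nspace \<Rightarrow> ('a \<Rightarrow> 'b) \<Rightarrow> bool" where
  "nbounded_linear V W T \<longleftrightarrow>
     nlinear V W T \<and> (\<exists>B. \<forall>x\<in>ncarrier V. nnorm W (T x) \<le> B * nnorm V x)"

text \<open>The case distinction makes the distance satisfy the unrestricted non-negativity and
  symmetry axioms of \<^locale>\<open>Metric_space\<close>.\<close>

definition ndist :: "'a nspace \<Rightarrow> 'a \<Rightarrow> 'a \<Rightarrow> real" where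
  "ndist V x y =
     (if x \<in> ncarrier V \<and> y \<in> ncarrier V then nnorm V (nadd V x (nscale V (-1) y)) else 0)"

definition ntopology :: "'a nspace \<Rightarrow> 'a topology" where
  "ntopology V = Metric_space.mtopology (ncarrier V) (ndist V)"

definition nisomorphic :: "'a nspace \<Rightarrow> 'b nspace \<Rightarrow> bool" where
  "nisomorphic V W \<longleftrightarrow>
     (\<exists>T. nlinear V W T \<and> homeomorphic_map (ntopology V) (ntopology W) T)"

definition projection :: "('a::real_normed_vector \<Rightarrow> 'a) \<Rightarrow> bool" where
  "projection P \<longleftrightarrow> bounded_linear P \<and> P \<circ> P = P"

definition complemented :: "'a::real_normed_vector set \<Rightarrow> bool" where
  "complemented Y \<longleftrightarrow> (\<exists>P. projection P \<and> range P = Y)"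

end

theory Submission
  imports Defs
begin

text \<open>
  Let \<open>Q f\<close> be \<open>P\<^sub>\<alpha> \<circ> f\<close> on \<open>K\<^sub>\<alpha>\<close> for every \<open>\<alpha>\<close>, and zero off \<open>\<Union>\<^sub>\<alpha> K\<^sub>\<alpha>\<close>. The complemented subspace
  is the range of \<open>Q\<close>, and restricting a function to the sets \<open>K\<^sub>\<alpha>\<close> is an isometry of this
  range onto the \<open>c\<^sub>0\<close>-sum.

  The point is that \<open>Q f\<close> is continuous. Pieces that are continuous on disjoint clopen sets can be
  pasted, with value zero elsewhere, as soon as their sup norms form a \<open>c\<^sub>0\<close>-family
  (\<open>continuous_on_paste\<close>). For the pieces \<open>P\<^sub>\<alpha> \<circ> f\<close> this holds because the operators \<open>P\<^sub>\<alpha>\<close> are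
  uniformly bounded and tend to zero pointwise, and hence tend to zero uniformly on the compact
  set \<open>f[K]\<close> (\<open>finite_large_on_compact\<close>). The same pasting lemma shows that the
  restriction map is onto: a member of the \<open>c\<^sub>0\<close>-sum pastes to a continuous function, which \<open>Q\<close>
  fixes since \<open>P\<^sub>\<alpha>\<close> is the identity on \<open>X\<^sub>\<alpha>\<close>.
\<close>

section \<open>Isometric isomorphisms\<close>

text \<open>
  A linear surjection that preserves norms is an isometry for the distances, so the metric
  axioms of the target need no separate verification: they are transported from the source.
\<close>

lemma nisomorphic_if_norm_preserving:
  fixes Y :: "'a::real_normed_vector set"
  assumes Y: "subspace Y"
    and lin: "nlinear (subspace_nspace Y) W T"
    and surj: "T ` Y = ncarrier W"
    and norm: "\<And>x. x \<in> Y \<Longrightarrow> nnorm W (T x) = norm x"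
  shows "nisomorphic (subspace_nspace Y) W"
proof -
  let ?V = "subspace_nspace Y"
  have car: "ncarrier ?V = Y"
    by (simp add: subspace_nspace_def)
  have neg: "- y \<in> Y" if "y \<in> Y" for y
    using subspace_scale[OF Y that, of "- 1"] by simp
  have T_add: "T (x + y) = nadd W (T x) (T y)" if "x \<in> Y" "y \<in> Y" for x y
    using lin that by (simp add: nlinear_def subspace_nspace_def)
  have T_scale: "T (c *\<^sub>R x) = nscale W c (T x)" if "x \<in> Y" for c x
    using lin that by (simp add: nlinear_def subspace_nspace_def)
  have dV: "ndist ?V x y = dist x y" if "x \<in> Y" "y \<in> Y" for x y
    using that by (simp add: ndist_def subspace_nspace_def dist_norm)
  have dW: "ndist W (T x) (T y) = dist x y" if xy: "x \<in> Y" "y \<in> Y" for x y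
  proof -
    have "nadd W (T x) (nscale W (- 1) (T y)) = T (x - y)"
      using T_add[OF xy(1) neg[OF xy(2)]] T_scale[OF xy(2), of "- 1"] by simp
    moreover have "T x \<in> ncarrier W" "T y \<in> ncarrier W"
      using xy surj by auto
    ultimately show ?thesis
      using norm[OF subspace_diff[OF Y xy]] by (simp add: ndist_def dist_norm)
  qed
  have MV: "Metric_space Y (ndist ?V)"
  proof
    show "0 \<le> ndist ?V x y" for x y
      by (simp add: ndist_def subspace_nspace_def)
    show "ndist ?V x y = ndist ?V y x" for x y
      by (cases "x \<in> Y \<and> y \<in> Y") (auto simp: dV dist_commute, auto simp: ndist_def car)
  qed (auto simp: dV dist_triangle)
  have MW: "Metric_space (ncarrier W) (ndist W)"
  proof
    show "0 \<le> ndist W u v" for u v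
    proof (cases "u \<in> ncarrier W \<and> v \<in> ncarrier W")
      case True
      then show ?thesis unfolding surj[symmetric] by (auto simp: dW)
    qed (auto simp: ndist_def)
    show "ndist W u v = ndist W v u" for u v
    proof (cases "u \<in> ncarrier W \<and> v \<in> ncarrier W")
      case True
      then show ?thesis unfolding surj[symmetric] by (auto simp: dW dist_commute)
    qed (auto simp: ndist_def)
    show "ndist W u v = 0 \<longleftrightarrow> u = v" if uv: "u \<in> ncarrier W" "v \<in> ncarrier W" for u v
    proof -
      obtain x y where xy: "x \<in> Y" "y \<in> Y" "u = T x" "v = T y"
        using uv unfolding surj[symmetric] by blast
      show ?thesis
        using xy dW[of x y] dW[of x x] by auto
    qed
    show "ndist W u w \<le> ndist W u v + ndist W v w"
      if "u \<in> ncarrier W" "v \<in> ncarrier W" "w \<in> ncarrier W" for u v w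
      using that unfolding surj[symmetric] by (auto simp: dW dist_triangle)
  qed
  interpret Metric_space12 Y "ndist ?V" "ncarrier W" "ndist W"
    using MV MW by (simp add: Metric_space12_def)
  have "homeomorphic_map M1.mtopology M2.mtopology T"
    by (rule isometry_imp_homeomorphic_map) (auto simp: surj dV dW)
  then have "homeomorphic_map (ntopology ?V) (ntopology W) T"
    by (simp add: ntopology_def car)
  then show ?thesis
    using lin unfolding nisomorphic_def by blast
qed

section \<open>Families in the \<open>c\<^sub>0\<close>-sum\<close>

lemma bdd_above_if_finite_large:
  fixes h :: "'i \<Rightarrow> real"
  assumes "finite {i \<in> I. c \<le> h i}"
  shows "bdd_above (h ` I)"
proof (rule bdd_above_mono)
  show "bdd_above (h ` {i \<in> I. c \<le> h i} \<union> {..c})"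
    using assms by simp
  show "h ` I \<subseteq> h ` {i \<in> I. c \<le> h i} \<union> {..c}"
    by force
qed

lemma norm_le_SUP_norm:
  assumes "compact A" "continuous_on A g" "t \<in> A"
  shows "norm (g t) \<le> (SUP t\<in>A. norm (g t))"
proof (rule cSUP_upper[OF \<open>t \<in> A\<close>])
  show "bdd_above ((\<lambda>t. norm (g t)) ` A)"
    using assms
    by (intro bounded_imp_bdd_above compact_imp_bounded compact_continuous_image
        continuous_intros)
qed

lemma le_SUP_norm_iff:
  assumes A: "compact A" "A \<noteq> {}" and g: "continuous_on A g"
  shows "\<epsilon> \<le> (SUP t\<in>A. norm (g t)) \<longleftrightarrow> (\<exists>t\<in>A. \<epsilon> \<le> norm (g t))"
proof
  have "continuous_on A (\<lambda>t. norm (g t))"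
    using g by (intro continuous_intros)
  then obtain s where s: "s \<in> A" "\<And>t. t \<in> A \<Longrightarrow> norm (g t) \<le> norm (g s)"
    using continuous_attains_sup[OF A, of "\<lambda>t. norm (g t)"] by blast
  then have "(SUP t\<in>A. norm (g t)) \<le> norm (g s)"
    using A by (intro cSUP_least) auto
  then show "\<exists>t\<in>A. \<epsilon> \<le> norm (g t)" if "\<epsilon> \<le> (SUP t\<in>A. norm (g t))"
    using that s by force
  show "\<epsilon> \<le> (SUP t\<in>A. norm (g t))" if "\<exists>t\<in>A. \<epsilon> \<le> norm (g t)"
    using that norm_le_SUP_norm[OF A(1) g] by force
qed

text \<open>
  An equicontinuous family that tends to zero pointwise does so uniformly on compact sets: all
  but finitely many operators are below \<open>\<epsilon>/2\<close> on a finite net of the compact set, and on the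
  rest of it the uniform bound adds at most \<open>\<epsilon>/2\<close>.
\<close>

lemma finite_large_on_compact:
  fixes P :: "'i \<Rightarrow> 'x::real_normed_vector \<Rightarrow> 'y::real_normed_vector"
  assumes lin: "\<And>i. i \<in> I \<Longrightarrow> linear (P i)"
    and B: "\<And>i x. i \<in> I \<Longrightarrow> norm (P i x) \<le> B * norm x"
    and pointwise: "\<And>x \<epsilon>. \<epsilon> > 0 \<Longrightarrow> finite {i \<in> I. \<epsilon> \<le> norm (P i x)}"
    and C: "compact C" and \<epsilon>: "\<epsilon> > 0"
  shows "finite {i \<in> I. \<exists>x\<in>C. \<epsilon> \<le> norm (P i x)}"
proof -
  \<comment> \<open>Adding one keeps the radius well defined when \<open>B\<close> vanishes.\<close>
  define \<delta> where "\<delta> = \<epsilon> / (2 * (\<bar>B\<bar> + 1))"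
  have "\<delta> > 0"
    using \<epsilon> by (simp add: \<delta>_def)
  then obtain N where N: "finite N" "C \<subseteq> (\<Union>z\<in>N. ball z \<delta>)"
    using C unfolding compact_eq_totally_bounded by blast
  have "\<exists>z\<in>N. \<epsilon>/2 \<le> norm (P i z)" if i: "i \<in> I" and x: "x \<in> C" "\<epsilon> \<le> norm (P i x)" for i x
  proof -
    obtain z where z: "z \<in> N" "dist z x < \<delta>"
      using N x by auto
    have "norm (P i (x - z)) \<le> B * norm (x - z)"
      using B i .
    also have "\<dots> \<le> (\<bar>B\<bar> + 1) * \<delta>"
      using z by (intro mult_mono) (auto simp: dist_norm norm_minus_commute)
    also have "\<dots> = \<epsilon>/2"
      by (simp add: \<delta>_def field_simps)
    finally have "norm (P i x - P i z) \<le> \<epsilon>/2"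
      using lin[OF i] by (simp add: linear_diff)
    then have "\<epsilon>/2 \<le> norm (P i z)"
      using x norm_triangle_ineq2[of "P i x" "P i z"] by linarith
    then show ?thesis using z by blast
  qed
  then have "{i \<in> I. \<exists>x\<in>C. \<epsilon> \<le> norm (P i x)} \<subseteq> (\<Union>z\<in>N. {i \<in> I. \<epsilon>/2 \<le> norm (P i z)})"
    by blast
  moreover have "finite (\<Union>z\<in>N. {i \<in> I. \<epsilon>/2 \<le> norm (P i z)})"
    using N \<epsilon> by (intro finite_UN_I pointwise) auto
  ultimately show ?thesis by (rule finite_subset)
qed

section \<open>Pasting functions on disjoint clopen sets\<close>

definition paste :: "'i set \<Rightarrow> ('i \<Rightarrow> 'k set) \<Rightarrow> ('i \<Rightarrow> 'k \<Rightarrow> 'x::zero) \<Rightarrow> 'k \<Rightarrow> 'x" where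
  "paste I A g t = (if \<exists>i\<in>I. t \<in> A i then g (THE i. i \<in> I \<and> t \<in> A i) t else 0)"

lemma paste_in:
  assumes "disjoint_family_on A I" "i \<in> I" "t \<in> A i"
  shows "paste I A g t = g i t"
proof -
  have "(THE i. i \<in> I \<and> t \<in> A i) = i"
    using assms by (intro the_equality) (auto simp: disjoint_family_on_def)
  then show ?thesis
    using assms by (auto simp: paste_def)
qed

lemma paste_out: "t \<notin> (\<Union>i\<in>I. A i) \<Longrightarrow> paste I A g t = 0"
  by (auto simp: paste_def)

text \<open>
  Continuity is clear inside each \<open>A i\<close>, which is open. At a point outside all of them the pasted
  function vanishes, and only finitely many of the sets carry values of norm at least
  \<open>\<epsilon>\<close>; those sets are closed, so the complement of their union is a neighbourhood of the point.
\<close>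

lemma continuous_on_paste:
  fixes g :: "'i \<Rightarrow> 'k::t2_space \<Rightarrow> 'x::real_normed_vector"
  assumes disj: "disjoint_family_on A I"
    and clopen: "\<And>i. i \<in> I \<Longrightarrow> open (A i)" "\<And>i. i \<in> I \<Longrightarrow> closed (A i)"
    and cont: "\<And>i. i \<in> I \<Longrightarrow> continuous_on (A i) (g i)"
    and fin: "\<And>\<epsilon>. \<epsilon> > 0 \<Longrightarrow> finite {i \<in> I. \<exists>t\<in>A i. \<epsilon> \<le> norm (g i t)}"
  shows "continuous_on UNIV (paste I A g)"
proof -
  have "isCont (paste I A g) t" for t
  proof (cases "\<exists>i\<in>I. t \<in> A i")
    case True
    then obtain i where i: "i \<in> I" "t \<in> A i" by blast
    have "continuous_on (A i) (paste I A g)"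
      by (rule continuous_on_eq[OF cont[OF i(1)]]) (simp add: paste_in[OF disj i(1)])
    then show ?thesis
      using clopen(1)[OF i(1)] i(2) by (simp add: continuous_on_eq_continuous_at)
  next
    case False
    have "\<forall>\<^sub>F s in at t. dist (paste I A g s) (paste I A g t) < \<epsilon>" if \<epsilon>: "\<epsilon> > 0" for \<epsilon>
    proof -
      define F where "F = {i \<in> I. \<exists>t\<in>A i. \<epsilon> \<le> norm (g i t)}"
      have "open (- (\<Union>i\<in>F. A i))"
        using fin[OF \<epsilon>] clopen(2) unfolding F_def by (intro open_Compl closed_UN) auto
      moreover have "t \<in> - (\<Union>i\<in>F. A i)"
        using False by (auto simp: F_def)
      moreover have "norm (paste I A g s) < \<epsilon>" if "s \<notin> (\<Union>i\<in>F. A i)" for s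
      proof (cases "\<exists>i\<in>I. s \<in> A i")
        case True
        then obtain i where "i \<in> I" "s \<in> A i" by blast
        then show ?thesis
          using that paste_in[OF disj, of i s g] by (force simp: F_def)
      qed (use \<epsilon> in \<open>simp add: paste_def\<close>)
      moreover have "paste I A g t = 0"
        using False by (intro paste_out) blast
      ultimately show ?thesis
        unfolding eventually_at_topological by auto
    qed
    then show ?thesis
      by (simp add: isCont_def tendsto_iff)
  qed
  then show ?thesis
    by (simp add: continuous_at_imp_continuous_on)
qed

lemma bcontfun_if_compact:
  fixes f :: "'k::topological_space \<Rightarrow> 'x::metric_space"
  assumes "compact (UNIV :: 'k set)" "continuous_on UNIV f"
  shows "f \<in> bcontfun"
  using assms by (simp add: bcontfun_def compact_continuous_image compact_imp_bounded)

section \<open>The complemented \<open>c\<^sub>0\<close>-sum\<close>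

theorem theorem3p1:
  fixes \<kappa> :: "'i rel"
    and Ks :: "'i \<Rightarrow> 'k::t2_space set"
    and P :: "'i \<Rightarrow> 'x::banach \<Rightarrow> 'x"
    and Xs :: "'i \<Rightarrow> 'x set"
  assumes "compact (UNIV :: 'k set)"
    and "Cinfinite \<kappa>"
    and "disjoint_family_on Ks (Field \<kappa>)"
    and "\<And>\<alpha>. \<alpha> \<in> Field \<kappa> \<Longrightarrow> Ks \<alpha> \<noteq> {} \<and> open (Ks \<alpha>) \<and> closed (Ks \<alpha>)"
    and "\<And>\<alpha>. \<alpha> \<in> Field \<kappa> \<Longrightarrow> projection (P \<alpha>)"
    and "\<And>\<alpha>. \<alpha> \<in> Field \<kappa> \<Longrightarrow> range (P \<alpha>) = Xs \<alpha>"
    and "nbounded_linear (subspace_nspace UNIV)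
           (c0_sum (Field \<kappa>) (\<lambda>\<alpha>. subspace_nspace (Xs \<alpha>)))
           (\<lambda>x. \<lambda>\<alpha>\<in>Field \<kappa>. P \<alpha> x)"
  shows "\<exists>Y :: ('k \<Rightarrow>\<^sub>C 'x) set. complemented Y \<and>
           nisomorphic (subspace_nspace Y) (c0_sum (Field \<kappa>) (\<lambda>\<alpha>. C_nspace (Ks \<alpha>) (Xs \<alpha>)))"
proof -
  define I where "I = Field \<kappa>"
  note I = I_def[symmetric]
  have I_ne: "I \<noteq> {}"
    using assms(2) by (auto simp: I_def cinfinite_def)
  have disj: "disjoint_family_on Ks I"
    using assms(3) by (simp add: I)
  have ne: "Ks \<alpha> \<noteq> {}" and op: "open (Ks \<alpha>)" and cl: "closed (Ks \<alpha>)" if "\<alpha> \<in> I" for \<alpha>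
    using assms(4) that by (auto simp: I)
  have cpt: "compact (Ks \<alpha>)" if "\<alpha> \<in> I" for \<alpha>
    using compact_Int_closed[OF assms(1) cl[OF that]] by simp
  have bl: "bounded_linear (P \<alpha>)" and idem: "P \<alpha> (P \<alpha> x) = P \<alpha> x" if "\<alpha> \<in> I" for \<alpha> x
    using assms(5)[of \<alpha>] that by (auto simp: I projection_def fun_eq_iff)
  have P_id: "P \<alpha> x = x" if "\<alpha> \<in> I" "x \<in> Xs \<alpha>" for \<alpha> x
    using assms(6)[of \<alpha>] that idem[OF that(1)] unfolding I by (metis rangeE)
  have P_in: "P \<alpha> x \<in> Xs \<alpha>" if "\<alpha> \<in> I" for \<alpha> x
    using assms(6)[of \<alpha>] that by (auto simp: I)
  obtain B where B: "\<And>x. (SUP \<alpha>\<in>I. norm (P \<alpha> x)) \<le> B * norm x"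
    and P_c0: "\<And>x \<epsilon>. \<epsilon> > 0 \<Longrightarrow> finite {\<alpha> \<in> I. \<epsilon> \<le> norm (P \<alpha> x)}"
    using assms(7)
    by (auto simp: I nbounded_linear_def nlinear_def c0_sum_def subspace_nspace_def
        Pi_iff cong: conj_cong)
  have P_le: "norm (P \<alpha> x) \<le> B * norm x" if "\<alpha> \<in> I" for \<alpha> x
    using cSUP_upper[OF that bdd_above_if_finite_large[OF P_c0[of 1]], of x] B[of x] by simp

  define q where "q f = paste I Ks (\<lambda>\<alpha> t. P \<alpha> (apply_bcontfun f t))" for f :: "'k \<Rightarrow>\<^sub>C 'x"
  have q_in: "q f t = P \<alpha> (f t)" if "\<alpha> \<in> I" "t \<in> Ks \<alpha>" for f \<alpha> t
    using paste_in[OF disj that] by (simp add: q_def)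
  have q_out: "q f t = 0" if "t \<notin> (\<Union>\<alpha>\<in>I. Ks \<alpha>)" for f t
    using paste_out[OF that] by (simp add: q_def)
  have Pf_cont: "continuous_on S (\<lambda>t. P \<alpha> (apply_bcontfun f t))" if "\<alpha> \<in> I" for S \<alpha> f
    by (rule bounded_linear.continuous_on[OF bl[OF that]]) simp
  have Pf_c0: "finite {\<alpha> \<in> I. \<exists>t\<in>Ks \<alpha>. \<epsilon> \<le> norm (P \<alpha> (apply_bcontfun f t))}" if "\<epsilon> > 0" for \<epsilon> f
  proof (rule finite_subset)
    show "finite {\<alpha> \<in> I. \<exists>x\<in>range (apply_bcontfun f). \<epsilon> \<le> norm (P \<alpha> x)}"
    proof (rule finite_large_on_compact[OF _ P_le P_c0 _ that])
      show "compact (range (apply_bcontfun f))"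
        using assms(1) by (intro compact_continuous_image) auto
    qed (auto intro: bl bounded_linear.linear)
  qed auto
  have "q f \<in> bcontfun" for f
    unfolding q_def
    by (intro bcontfun_if_compact assms(1) continuous_on_paste disj op cl Pf_cont Pf_c0)
  then have Q_apply: "apply_bcontfun (Bcontfun (q f)) = q f" for f
    by (simp add: Bcontfun_inverse)

  define Q where "Q f = Bcontfun (q f)" for f
  have Q_in: "Q f t = P \<alpha> (f t)" if "\<alpha> \<in> I" "t \<in> Ks \<alpha>" for f \<alpha> t
    using q_in[OF that] by (simp add: Q_def Q_apply)
  have Q_out: "Q f t = 0" if "t \<notin> (\<Union>\<alpha>\<in>I. Ks \<alpha>)" for f t
    using q_out[OF that] by (simp add: Q_def Q_apply)
  have Q_eqI: "Q f = g"
    if "\<And>\<alpha> t. \<alpha> \<in> I \<Longrightarrow> t \<in> Ks \<alpha> \<Longrightarrow> P \<alpha> (f t) = g t" "\<And>t. t \<notin> (\<Union>\<alpha>\<in>I. Ks \<alpha>) \<Longrightarrow> g t = 0"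
    for f g :: "'k \<Rightarrow>\<^sub>C 'x"
  proof (rule bcontfun_eqI)
    show "Q f t = g t" for t
      using that Q_in Q_out by (cases "t \<in> (\<Union>\<alpha>\<in>I. Ks \<alpha>)") auto
  qed
  have Q_bl: "bounded_linear Q"
  proof (rule bounded_linear_intro[where K = "\<bar>B\<bar>"])
    show "Q (f + g) = Q f + Q g" for f g
      by (rule Q_eqI) (auto simp: Q_in Q_out linear_add[OF bounded_linear.linear[OF bl]])
    show "Q (c *\<^sub>R f) = c *\<^sub>R Q f" for c f
      by (rule Q_eqI) (auto simp: Q_in Q_out linear_scale[OF bounded_linear.linear[OF bl]])
    show "norm (Q f) \<le> norm f * \<bar>B\<bar>" for f
    proof (rule norm_bound)
      fix t
      show "norm (Q f t) \<le> norm f * \<bar>B\<bar>"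
      proof (cases "t \<in> (\<Union>\<alpha>\<in>I. Ks \<alpha>)")
        case True
        then obtain \<alpha> where \<alpha>: "\<alpha> \<in> I" "t \<in> Ks \<alpha>" by blast
        have "norm (Q f t) \<le> B * norm (f t)"
          using P_le[OF \<alpha>(1)] by (simp add: Q_in[OF \<alpha>])
        also have "\<dots> \<le> \<bar>B\<bar> * norm f"
          by (intro mult_mono norm_bounded) auto
        finally show ?thesis by (simp add: mult.commute)
      qed (simp add: Q_out)
    qed
  qed
  have QQ: "Q (Q f) = Q f" for f
    by (rule Q_eqI) (auto simp: Q_in Q_out idem)

  define Y where "Y = range Q"
  have Y_Q: "Q f = f" if "f \<in> Y" for f
    using that QQ by (auto simp: Y_def)
  have Y_in: "f t = P \<alpha> (f t)" if "f \<in> Y" "\<alpha> \<in> I" "t \<in> Ks \<alpha>" for f \<alpha> t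
    using Q_in[OF that(2,3), of f] by (simp add: Y_Q[OF that(1)])
  have Y_out: "f t = 0" if "f \<in> Y" "t \<notin> (\<Union>\<alpha>\<in>I. Ks \<alpha>)" for f t
    using Q_out[OF that(2), of f] by (simp add: Y_Q[OF that(1)])
  have compl: "complemented Y"
    using Q_bl QQ by (auto simp: complemented_def projection_def Y_def fun_eq_iff)
  have Y_sub: "subspace Y"
    unfolding Y_def using Q_bl by (intro linear_subspace_image bounded_linear.linear) auto

  define W where "W = c0_sum I (\<lambda>\<alpha>. C_nspace (Ks \<alpha>) (Xs \<alpha>))"
  have W_carrier: "x \<in> ncarrier W \<longleftrightarrow>
      x \<in> (\<Pi>\<^sub>E \<alpha>\<in>I. Ks \<alpha> \<rightarrow>\<^sub>E Xs \<alpha>) \<and> (\<forall>\<alpha>\<in>I. continuous_on (Ks \<alpha>) (x \<alpha>)) \<and>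
      (\<forall>\<epsilon>>0. finite {\<alpha> \<in> I. \<exists>t\<in>Ks \<alpha>. \<epsilon> \<le> norm (x \<alpha> t)})" for x
  proof -
    have "{\<alpha> \<in> I. \<epsilon> \<le> (SUP t\<in>Ks \<alpha>. norm (x \<alpha> t))} = {\<alpha> \<in> I. \<exists>t\<in>Ks \<alpha>. \<epsilon> \<le> norm (x \<alpha> t)}"
      if "\<forall>\<alpha>\<in>I. continuous_on (Ks \<alpha>) (x \<alpha>)" for \<epsilon>
      using that le_SUP_norm_iff[OF cpt ne] by blast
    then show ?thesis
      by (auto simp: W_def c0_sum_def C_nspace_def PiE_iff)
  qed
  define T where "T f = (\<lambda>\<alpha>\<in>I. \<lambda>t\<in>Ks \<alpha>. apply_bcontfun f t)" for f :: "'k \<Rightarrow>\<^sub>C 'x"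
  have T_W: "T f \<in> ncarrier W" if "f \<in> Y" for f
  proof -
    have "f t \<in> Xs \<alpha>" if "\<alpha> \<in> I" "t \<in> Ks \<alpha>" for \<alpha> t
      using Y_in[OF \<open>f \<in> Y\<close> that] P_in[OF that(1), of "f t"] by simp
    moreover have "continuous_on (Ks \<alpha>) (T f \<alpha>)" if "\<alpha> \<in> I" for \<alpha>
      using that continuous_on_apply_bcontfun[of "Ks \<alpha>" f] by (simp add: T_def cong: continuous_on_cong)
    moreover have "finite {\<alpha> \<in> I. \<exists>t\<in>Ks \<alpha>. \<epsilon> \<le> norm (T f \<alpha> t)}" if "\<epsilon> > 0" for \<epsilon>
    proof -
      have "{\<alpha> \<in> I. \<exists>t\<in>Ks \<alpha>. \<epsilon> \<le> norm (T f \<alpha> t)} = {\<alpha> \<in> I. \<exists>t\<in>Ks \<alpha>. \<epsilon> \<le> norm (P \<alpha> (f t))}"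
        using Y_in[OF \<open>f \<in> Y\<close>] by (auto simp: T_def)
      then show ?thesis using Pf_c0[OF that, of f] by simp
    qed
    ultimately show ?thesis
      unfolding W_carrier by (auto simp: T_def)
  qed
  have T_lin: "nlinear (subspace_nspace Y) W T"
    using T_W by (auto simp: nlinear_def subspace_nspace_def W_def c0_sum_def C_nspace_def T_def
        fun_eq_iff restrict_def)
  have T_norm: "nnorm W (T f) = norm f" if f: "f \<in> Y" for f
  proof -
    have "nnorm W (T f) = (SUP \<alpha>\<in>I. SUP t\<in>Ks \<alpha>. norm (f t))"
      by (simp add: W_def c0_sum_def C_nspace_def T_def cong: SUP_cong)
    moreover have "(SUP \<alpha>\<in>I. SUP t\<in>Ks \<alpha>. norm (f t)) = norm f"
    proof (rule antisym)
      have le: "(SUP t\<in>Ks \<alpha>. norm (f t)) \<le> norm f" if "\<alpha> \<in> I" for \<alpha>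
        using ne[OF that] by (intro cSUP_least norm_bounded)
      then show "(SUP \<alpha>\<in>I. SUP t\<in>Ks \<alpha>. norm (f t)) \<le> norm f"
        by (rule cSUP_least[OF I_ne])
      have upper: "norm (f t) \<le> (SUP \<alpha>\<in>I. SUP t\<in>Ks \<alpha>. norm (f t))" if "\<alpha> \<in> I" "t \<in> Ks \<alpha>" for \<alpha> t
      proof (rule order_trans)
        show "norm (f t) \<le> (SUP t\<in>Ks \<alpha>. norm (f t))"
          using that cpt by (intro norm_le_SUP_norm) auto
        show "\<dots> \<le> (SUP \<alpha>\<in>I. SUP t\<in>Ks \<alpha>. norm (f t))"
          by (rule cSUP_upper[OF that(1) bdd_aboveI2[OF le]])
      qed
      \<comment> \<open>Off the sets \<open>K\<^sub>\<alpha>\<close>, where \<open>f\<close> vanishes, the estimate needs that the supremum is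
        non-negative; this uses one point of one of the sets.\<close>
      obtain \<alpha> t where "\<alpha> \<in> I" "t \<in> Ks \<alpha>"
        using I_ne ne by blast
      then have nonneg: "0 \<le> (SUP \<alpha>\<in>I. SUP t\<in>Ks \<alpha>. norm (f t))"
        using upper norm_ge_zero order_trans by blast
      show "norm f \<le> (SUP \<alpha>\<in>I. SUP t\<in>Ks \<alpha>. norm (f t))"
      proof (rule norm_bound)
        show "norm (f t) \<le> (SUP \<alpha>\<in>I. SUP t\<in>Ks \<alpha>. norm (f t))" for t
          using upper nonneg Y_out[OF f, of t] by (cases "t \<in> (\<Union>\<alpha>\<in>I. Ks \<alpha>)") auto
      qed
    qed
    ultimately show ?thesis by simp
  qed
  have "x \<in> T ` Y" if x: "x \<in> ncarrier W" for x
  proof -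
    have "paste I Ks x \<in> bcontfun"
      using x unfolding W_carrier
      by (intro bcontfun_if_compact assms(1) continuous_on_paste disj op cl) auto
    then obtain f where f: "paste I Ks x = apply_bcontfun f"
      by (rule bcontfunE)
    have f_in: "f t = x \<alpha> t" if "\<alpha> \<in> I" "t \<in> Ks \<alpha>" for \<alpha> t
      using paste_in[OF disj that] by (simp flip: f)
    have "Q f = f"
    proof (rule Q_eqI)
      show "P \<alpha> (f t) = f t" if "\<alpha> \<in> I" "t \<in> Ks \<alpha>" for \<alpha> t
        using x that unfolding W_carrier by (auto simp: f_in intro!: P_id)
      show "f t = 0" if "t \<notin> (\<Union>\<alpha>\<in>I. Ks \<alpha>)" for t
        using paste_out[OF that] by (simp flip: f)
    qed
    then have "f \<in> Y"
      unfolding Y_def by (metis rangeI)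
    moreover have "T f = x"
    proof
      fix \<alpha>
      show "T f \<alpha> = x \<alpha>"
      proof (cases "\<alpha> \<in> I")
        case True
        then have "x \<alpha> \<in> extensional (Ks \<alpha>)"
          using x unfolding W_carrier by (auto simp: PiE_iff)
        then show ?thesis
          using True f_in by (auto simp: T_def fun_eq_iff extensional_def)
      next
        case False
        then show ?thesis
          using x unfolding W_carrier by (auto simp: T_def PiE_iff extensional_def)
      qed
    qed
    ultimately show ?thesis by blast
  qed
  then have "T ` Y = ncarrier W"
    using T_W by blast
  then have "nisomorphic (subspace_nspace Y) W"
    using nisomorphic_if_norm_preserving[OF Y_sub T_lin] T_norm by blast
  then show ?thesis
    using compl unfolding W_def I_def by blast
qed

end
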